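(* Let $K$ be a field of characteristic $\neq 2$, let $V$ be a $K$-vector space, let $\mathcal{F}$ be a pencil of quadrics in the projective space $P(V)$ (of any dimension), and let $\ell = P(E)$ be a line in $P(V)$, where $E \subseteq V$ is a subspace of linear dimension $2$. Then the following are equivalent. (A) The quadrics of $\mathcal{F}$ intersect $\ell$, when they do, in pairs of points conjugate under an involution; that is, there is an involution $\sigma$ of $\ell$ such that for every quadric $Q$ in $\mathcal{F}$ with $Q \cap \ell \neq \emptyset$ one has $Q \cap \ell = \{P, \sigma(P)\}$ for some point $P \in \ell$ (with $P = \sigma(P)$ allowed). (B) Both of the following hold: (i) $\ell$ is not contained in any quadric of the pencil $\mathcal{F}$; and (ii) $\ell$ contains no common zero point of all the quadrics of $\mathcal{F}$. (C) The pencil $\mathcal{F}$ contains two quadrics whose sets of intersection points with $\ell$ over an algebraic closure $L$ of $K$ (i.e., their zero sets in $P(E \otimes_K L)$) are disjoint.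
   Context: For a $K$-vector space $W$, $P(W)$ denotes the set of lines through the origin in $W$. A quadric in $P(V)$ is given by a non-zero symmetric bilinear form $q : V \times V \to K$ (taken up to a non-zero scalar); its points (zero points, or isotropic points) are the points of $P(V)$ represented by non-zero vectors $v$ with $q(v,v)=0$. A pencil of quadrics is a linear system of projective dimension $1$: the family of quadrics given by the forms $aR + bS$, with $(a,b) \in K^2 \setminus \{(0,0)\}$, where $R$ and $S$ are two fixed linearly independent symmetric bilinear forms on $V$. For a field extension $L$ of $K$, each form is extended to $V \otimes_K L$ by extension of scalars. An involution of a projective line $\ell = P(E)$ is a projective transformation of $\ell$ (a map induced by an invertible $K$-linear transformation of $E$) that has order exactly two. Points $P, P'$ are conjugate under an involution $\sigma$ if $P' = \sigma(P)$. *)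

theory Defs
  imports
    "HOL-Computational_Algebra.Polynomial"
    "HOL-Library.Poly_Mapping"
begin

section \<open>Projective spaces\<close>

text \<open>
  The set of lines through the origin of a vector space, given by its scalar multiplication,
  its zero vector and its carrier. The zero vector is a parameter because for \<open>E \<otimes>\<^sub>K L\<close>
  below it is the coset of \<open>0\<close>.
\<close>

definition proj_space :: "('c \<Rightarrow> 'w \<Rightarrow> 'w) \<Rightarrow> 'w \<Rightarrow> 'w set \<Rightarrow> 'w set set" where
  "proj_space smul z W = {{smul c w | c. True} | w. w \<in> W \<and> w \<noteq> z}"

definition linear_automorphism_on ::
    "('k::field \<Rightarrow> 'v::ab_group_add \<Rightarrow> 'v) \<Rightarrow> 'v set \<Rightarrow> ('v \<Rightarrow> 'v) \<Rightarrow> bool" where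
  "linear_automorphism_on scale E f \<longleftrightarrow>
     (\<forall>x\<in>E. \<forall>y\<in>E. f (x + y) = f x + f y) \<and>
     (\<forall>c. \<forall>x\<in>E. f (scale c x) = scale c (f x)) \<and>
     bij_betw f E E"

definition projective_transformation ::
    "('k::field \<Rightarrow> 'v::ab_group_add \<Rightarrow> 'v) \<Rightarrow> 'v set \<Rightarrow> ('v set \<Rightarrow> 'v set) \<Rightarrow> bool" where
  "projective_transformation scale E \<sigma> \<longleftrightarrow>
     (\<exists>f. linear_automorphism_on scale E f \<and> (\<forall>p\<in>proj_space scale 0 E. \<sigma> p = f ` p))"

definition involution ::
    "('k::field \<Rightarrow> 'v::ab_group_add \<Rightarrow> 'v) \<Rightarrow> 'v set \<Rightarrow> ('v set \<Rightarrow> 'v set) \<Rightarrow> bool" where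
  "involution scale E \<sigma> \<longleftrightarrow>
     projective_transformation scale E \<sigma> \<and>
     (\<forall>p\<in>proj_space scale 0 E. \<sigma> (\<sigma> p) = p) \<and>
     (\<exists>p\<in>proj_space scale 0 E. \<sigma> p \<noteq> p)"


section \<open>Quadrics and pencils\<close>

definition sym_bilinear ::
    "('k::field \<Rightarrow> 'v::ab_group_add \<Rightarrow> 'v) \<Rightarrow> ('v \<Rightarrow> 'v \<Rightarrow> 'k) \<Rightarrow> bool" where
  "sym_bilinear scale q \<longleftrightarrow>
     (\<forall>x y. q x y = q y x) \<and> (\<forall>x. Vector_Spaces.linear scale (*) (q x))"

definition independent_forms ::
    "('v \<Rightarrow> 'v \<Rightarrow> 'k::field) \<Rightarrow> ('v \<Rightarrow> 'v \<Rightarrow> 'k) \<Rightarrow> bool" where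
  "independent_forms R S \<longleftrightarrow>
     (\<forall>a b. (\<forall>x y. a * R x y + b * S x y = 0) \<longrightarrow> a = 0 \<and> b = 0)"

text \<open>A quadric is a form up to a non-zero scalar, i.e. a class of proportional forms.\<close>

definition quadric :: "('v \<Rightarrow> 'v \<Rightarrow> 'k::field) \<Rightarrow> ('v \<Rightarrow> 'v \<Rightarrow> 'k) set" where
  "quadric q = {\<lambda>x y. c * q x y | c. c \<noteq> 0}"

definition pencil ::
    "('v \<Rightarrow> 'v \<Rightarrow> 'k::field) \<Rightarrow> ('v \<Rightarrow> 'v \<Rightarrow> 'k) \<Rightarrow> ('v \<Rightarrow> 'v \<Rightarrow> 'k) set set" where
  "pencil R S = {quadric (\<lambda>x y. a * R x y + b * S x y) | a b. (a, b) \<noteq> (0, 0)}"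

definition quadric_points ::
    "('k::field \<Rightarrow> 'v::ab_group_add \<Rightarrow> 'v) \<Rightarrow> ('v \<Rightarrow> 'v \<Rightarrow> 'k) set \<Rightarrow> 'v set set" where
  "quadric_points scale Q =
     {p \<in> proj_space scale 0 UNIV. \<exists>q\<in>Q. \<exists>v\<in>p. v \<noteq> 0 \<and> q v v = 0}"


section \<open>Algebraic closures\<close>

text \<open>
  \<open>emb\<close> exhibits the algebraically closed field \<open>'l\<close> as an algebraic closure of \<open>'k\<close>;
  an instance is \<open>to_ac\<close> of \<open>HOL-Algebra.Algebraic_Closure_Type\<close>.
\<close>

locale alg_closure_embedding =
  fixes emb :: "'k::field \<Rightarrow> 'l::alg_closed_field"
  assumes hom_add: "emb (a + b) = emb a + emb b"
    and hom_mult: "emb (a * b) = emb a * emb b"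
    and hom_one: "emb 1 = 1"
    and algebraic: "\<exists>p. p \<noteq> 0 \<and> poly (map_poly emb p) x = 0"


section \<open>Extension of scalars\<close>

text \<open>
  For a subspace \<open>E\<close>, the space \<open>E \<otimes>\<^sub>K L\<close> is the group of formal sums of symbols
  \<open>v \<otimes> a = Poly_Mapping.single v a\<close>, with \<open>v \<in> E\<close> and \<open>a \<in> L\<close>, modulo the usual relations.
  Additivity in \<open>a\<close> already holds for formal sums with coefficients in \<open>L\<close>.
\<close>

definition formal_tensors :: "'v set \<Rightarrow> ('v \<Rightarrow>\<^sub>0 'l::field) set" where
  "formal_tensors E = {x. Poly_Mapping.keys x \<subseteq> E}"

inductive_set tensor_null ::
    "('k::field \<Rightarrow> 'v::ab_group_add \<Rightarrow> 'v) \<Rightarrow> ('k \<Rightarrow> 'l::field) \<Rightarrow> 'v set \<Rightarrow> ('v \<Rightarrow>\<^sub>0 'l) set"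
  for scale emb E where
  zero: "0 \<in> tensor_null scale emb E"
| diff: "x \<in> tensor_null scale emb E \<Longrightarrow> y \<in> tensor_null scale emb E \<Longrightarrow> x - y \<in> tensor_null scale emb E"
| add: "v \<in> E \<Longrightarrow> w \<in> E \<Longrightarrow>
    Poly_Mapping.single (v + w) a - Poly_Mapping.single v a - Poly_Mapping.single w a
      \<in> tensor_null scale emb E"
| scale: "v \<in> E \<Longrightarrow>
    Poly_Mapping.single (scale c v) a - Poly_Mapping.single v (emb c * a) \<in> tensor_null scale emb E"

definition tensor_rel ::
    "('k::field \<Rightarrow> 'v::ab_group_add \<Rightarrow> 'v) \<Rightarrow> ('k \<Rightarrow> 'l::field) \<Rightarrow> 'v set \<Rightarrow>
     (('v \<Rightarrow>\<^sub>0 'l) \<times> ('v \<Rightarrow>\<^sub>0 'l)) set" where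
  "tensor_rel scale emb E =
     {(x, y). x \<in> formal_tensors E \<and> y \<in> formal_tensors E \<and> x - y \<in> tensor_null scale emb E}"

definition tensor ::
    "('k::field \<Rightarrow> 'v::ab_group_add \<Rightarrow> 'v) \<Rightarrow> ('k \<Rightarrow> 'l::field) \<Rightarrow> 'v set \<Rightarrow> ('v \<Rightarrow>\<^sub>0 'l) set set" where
  "tensor scale emb E = formal_tensors E // tensor_rel scale emb E"

definition tensor_zero ::
    "('k::field \<Rightarrow> 'v::ab_group_add \<Rightarrow> 'v) \<Rightarrow> ('k \<Rightarrow> 'l::field) \<Rightarrow> 'v set \<Rightarrow> ('v \<Rightarrow>\<^sub>0 'l) set" where
  "tensor_zero scale emb E = tensor_rel scale emb E `` {0}"

definition tensor_smult ::
    "('k::field \<Rightarrow> 'v::ab_group_add \<Rightarrow> 'v) \<Rightarrow> ('k \<Rightarrow> 'l::field) \<Rightarrow> 'v set \<Rightarrow>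
     'l \<Rightarrow> ('v \<Rightarrow>\<^sub>0 'l) set \<Rightarrow> ('v \<Rightarrow>\<^sub>0 'l) set" where
  "tensor_smult scale emb E c X =
     (\<Union>x\<in>X. tensor_rel scale emb E `` {Poly_Mapping.map ((*) c) x})"

text \<open>The extended form is determined by \<open>q\<^sub>L (v \<otimes> a) (w \<otimes> b) = a b q(v,w)\<close>.\<close>

definition formal_form ::
    "('k::field \<Rightarrow> 'l::field) \<Rightarrow> ('v \<Rightarrow> 'v \<Rightarrow> 'k) \<Rightarrow> ('v \<Rightarrow>\<^sub>0 'l) \<Rightarrow> ('v \<Rightarrow>\<^sub>0 'l) \<Rightarrow> 'l" where
  "formal_form emb q x y =
     (\<Sum>v\<in>Poly_Mapping.keys x. \<Sum>w\<in>Poly_Mapping.keys y.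
        Poly_Mapping.lookup x v * Poly_Mapping.lookup y w * emb (q v w))"

definition tensor_form ::
    "('k::field \<Rightarrow> 'l::field) \<Rightarrow> ('v \<Rightarrow> 'v \<Rightarrow> 'k) \<Rightarrow> ('v \<Rightarrow>\<^sub>0 'l) set \<Rightarrow> ('v \<Rightarrow>\<^sub>0 'l) set \<Rightarrow> 'l" where
  "tensor_form emb q X Y = the_elem (\<Union>x\<in>X. \<Union>y\<in>Y. {formal_form emb q x y})"

definition quadric_points_ext ::
    "('k::field \<Rightarrow> 'v::ab_group_add \<Rightarrow> 'v) \<Rightarrow> ('k \<Rightarrow> 'l::field) \<Rightarrow> 'v set \<Rightarrow>
     ('v \<Rightarrow> 'v \<Rightarrow> 'k) set \<Rightarrow> ('v \<Rightarrow>\<^sub>0 'l) set set set" where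
  "quadric_points_ext scale emb E Q =
     {p \<in> proj_space (tensor_smult scale emb E) (tensor_zero scale emb E) (tensor scale emb E).
        \<exists>q\<in>Q. \<exists>X\<in>p. X \<noteq> tensor_zero scale emb E \<and> tensor_form emb q X X = 0}"


subsection \<open>The operations on cosets are well defined\<close>

lemma tensor_null_uminus:
  "x \<in> tensor_null scale emb E \<Longrightarrow> - x \<in> tensor_null scale emb E"
  using tensor_null.diff[OF tensor_null.zero, of x scale emb E] by simp

lemma tensor_null_add:
  "x \<in> tensor_null scale emb E \<Longrightarrow> y \<in> tensor_null scale emb E \<Longrightarrow> x + y \<in> tensor_null scale emb E"
  using tensor_null.diff[OF _ tensor_null_uminus, of x scale emb E y] by simp

lemma equiv_tensor_rel: "equiv (formal_tensors E) (tensor_rel scale emb E)"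
proof (rule equivI)
  show "tensor_rel scale emb E \<subseteq> formal_tensors E \<times> formal_tensors E"
    by (auto simp: tensor_rel_def)
  show "refl_on (formal_tensors E) (tensor_rel scale emb E)"
    by (auto simp: refl_on_def tensor_rel_def tensor_null.zero)
  show "sym (tensor_rel scale emb E)"
    by (rule symI) (auto simp: tensor_rel_def dest: tensor_null_uminus)
  show "trans (tensor_rel scale emb E)"
    by (rule transI) (auto simp: tensor_rel_def dest: tensor_null_add)
qed

lemma map_times_diff:
  fixes x y :: "'v \<Rightarrow>\<^sub>0 'l::field"
  shows "Poly_Mapping.map ((*) c) (x - y) = Poly_Mapping.map ((*) c) x - Poly_Mapping.map ((*) c) y"
  by (rule poly_mapping_eqI)
    (simp add: Poly_Mapping.map.rep_eq lookup_minus algebra_simps when_def)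

lemma tensor_null_smult:
  fixes x :: "'v::ab_group_add \<Rightarrow>\<^sub>0 'l::field"
  shows "x \<in> tensor_null scale emb E \<Longrightarrow> Poly_Mapping.map ((*) c) x \<in> tensor_null scale emb E"
proof (induction rule: tensor_null.induct)
  case zero
  have "Poly_Mapping.map ((*) c) (0 :: 'v \<Rightarrow>\<^sub>0 'l) = 0"
    by (rule poly_mapping_eqI) (simp add: Poly_Mapping.map.rep_eq)
  then show ?case by (simp add: tensor_null.zero)
next
  case (diff x y)
  then show ?case by (simp add: map_times_diff tensor_null.diff)
next
  case (add v w a)
  then show ?case by (simp add: map_times_diff tensor_null.add)
next
  case (scale v d a)
  then show ?case
    using tensor_null.scale[of v E scale d "c * a" emb]
    by (simp add: map_times_diff mult.left_commute)
qed

lemma tensor_smult_class: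
  assumes "x \<in> formal_tensors E"
  shows "tensor_smult scale emb E c (tensor_rel scale emb E `` {x}) =
    tensor_rel scale emb E `` {Poly_Mapping.map ((*) c) x}"
  unfolding tensor_smult_def
proof (rule UN_equiv_class[OF equiv_tensor_rel _ assms])
  have keys: "Poly_Mapping.map ((*) c) y \<in> formal_tensors E" if "y \<in> formal_tensors E" for y :: "'a \<Rightarrow>\<^sub>0 'b"
    using that by (auto simp: formal_tensors_def in_keys_iff Poly_Mapping.map.rep_eq when_def split: if_splits)
  show "(\<lambda>x. tensor_rel scale emb E `` {Poly_Mapping.map ((*) c) x}) respects tensor_rel scale emb E"
  proof (rule congruentI)
    fix y z assume yz: "(y, z) \<in> tensor_rel scale emb E"
    then have "(Poly_Mapping.map ((*) c) y, Poly_Mapping.map ((*) c) z) \<in> tensor_rel scale emb E"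
      using tensor_null_smult[of "y - z" scale emb E c]
      by (simp add: tensor_rel_def keys map_times_diff)
    then show "tensor_rel scale emb E `` {Poly_Mapping.map ((*) c) y} =
        tensor_rel scale emb E `` {Poly_Mapping.map ((*) c) z}"
      by (rule equiv_class_eq[OF equiv_tensor_rel])
  qed
qed

lemma formal_form_superset:
  assumes "finite A" "Poly_Mapping.keys x \<subseteq> A" "finite B" "Poly_Mapping.keys y \<subseteq> B"
  shows "formal_form emb q x y = (\<Sum>v\<in>A. \<Sum>w\<in>B.
    Poly_Mapping.lookup x v * Poly_Mapping.lookup y w * emb (q v w))"
proof -
  have "formal_form emb q x y = (\<Sum>v\<in>Poly_Mapping.keys x. \<Sum>w\<in>B.
      Poly_Mapping.lookup x v * Poly_Mapping.lookup y w * emb (q v w))"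
    unfolding formal_form_def
    by (intro sum.cong refl sum.mono_neutral_left) (use assms in \<open>auto simp: in_keys_iff\<close>)
  also have "\<dots> = (\<Sum>v\<in>A. \<Sum>w\<in>B.
      Poly_Mapping.lookup x v * Poly_Mapping.lookup y w * emb (q v w))"
    by (intro sum.mono_neutral_left) (use assms in \<open>auto simp: in_keys_iff\<close>)
  finally show ?thesis .
qed

lemma formal_form_diff_left:
  "formal_form emb q (x - y) z = formal_form emb q x z - formal_form emb q y z"
proof -
  define A where "A = Poly_Mapping.keys x \<union> Poly_Mapping.keys y"
  have A: "finite A" "Poly_Mapping.keys x \<subseteq> A" "Poly_Mapping.keys y \<subseteq> A"
    "Poly_Mapping.keys (x - y) \<subseteq> A"
    by (auto simp: A_def in_keys_iff lookup_minus)
  show ?thesis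
    using A by (simp add: formal_form_superset[of A _ "Poly_Mapping.keys z"] lookup_minus
        algebra_simps sum_subtractf)
qed

lemma formal_form_commute:
  "(\<And>v w. q v w = q w v) \<Longrightarrow> formal_form emb q x y = formal_form emb q y x"
  unfolding formal_form_def by (subst sum.swap) (simp add: mult.commute)

lemma formal_form_single:
  "formal_form emb q (Poly_Mapping.single v a) y =
    a * (\<Sum>w\<in>Poly_Mapping.keys y. Poly_Mapping.lookup y w * emb (q v w))"
  by (simp add: formal_form_superset[of "{v}" _ "Poly_Mapping.keys y"] sum_distrib_left mult.assoc)

lemma sym_bilinear_left:
  assumes "sym_bilinear scale q"
  shows "q (v + w) u = q v u + q w u" "q (scale c v) u = c * q v u"
proof -
  have sym: "q x y = q y x" for x y
    using assms by (simp add: sym_bilinear_def)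
  interpret Vector_Spaces.linear scale "(*)" "q u"
    using assms by (simp add: sym_bilinear_def)
  show "q (v + w) u = q v u + q w u"
    unfolding sym[of _ u] by (rule add)
  show "q (scale c v) u = c * q v u"
    unfolding sym[of _ u] by (rule scale)
qed

lemma formal_form_null:
  assumes "alg_closure_embedding emb" "sym_bilinear scale q" "x \<in> tensor_null scale emb E"
  shows "formal_form emb q x y = 0"
  using assms(3)
proof (induction rule: tensor_null.induct)
  case zero
  then show ?case by (simp add: formal_form_def)
next
  case (diff x y)
  then show ?case by (simp add: formal_form_diff_left)
next
  case (add v w a)
  have "q (v + w) u = q v u + q w u" for u
    using assms(2) by (simp add: sym_bilinear_left)
  then show ?case
    using alg_closure_embedding.hom_add[OF assms(1)]
    by (simp add: formal_form_diff_left formal_form_single distrib_left sum.distrib)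
next
  case (scale v c a)
  have "q (scale c v) u = c * q v u" for u
    using assms(2) by (simp add: sym_bilinear_left)
  then show ?case
    using alg_closure_embedding.hom_mult[OF assms(1)]
    by (simp add: formal_form_diff_left formal_form_single sum_distrib_left mult_ac)
qed

lemma tensor_form_class:
  assumes "alg_closure_embedding emb" "sym_bilinear scale q"
    and "x \<in> formal_tensors E" "y \<in> formal_tensors E"
  shows "tensor_form emb q (tensor_rel scale emb E `` {x}) (tensor_rel scale emb E `` {y}) =
    formal_form emb q x y"
proof -
  have sym: "formal_form emb q u v = formal_form emb q v u" for u v
    using assms(2) by (intro formal_form_commute) (simp add: sym_bilinear_def)
  have left: "formal_form emb q u w = formal_form emb q v w" if "(u, v) \<in> tensor_rel scale emb E" for u v w
    using formal_form_null[OF assms(1,2), of "u - v" E w] that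
    by (simp add: tensor_rel_def formal_form_diff_left)
  have eq: "formal_form emb q u v = formal_form emb q x y"
    if "(x, u) \<in> tensor_rel scale emb E" "(y, v) \<in> tensor_rel scale emb E" for u v
    using left[OF that(1), of y] left[OF that(2), of u] sym by metis
  have refl: "(u, u) \<in> tensor_rel scale emb E" if "u \<in> formal_tensors E" for u
    using that by (simp add: tensor_rel_def tensor_null.zero)
  have "(\<Union>u\<in>tensor_rel scale emb E `` {x}. \<Union>v\<in>tensor_rel scale emb E `` {y}. {formal_form emb q u v}) =
      {formal_form emb q x y}"
  proof (rule set_eqI, rule iffI)
    fix c assume "c \<in> {formal_form emb q x y}"
    then show "c \<in> (\<Union>u\<in>tensor_rel scale emb E `` {x}. \<Union>v\<in>tensor_rel scale emb E `` {y}. {formal_form emb q u v})"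
      using refl[OF assms(3)] refl[OF assms(4)] by blast
  next
    fix c
    assume "c \<in> (\<Union>u\<in>tensor_rel scale emb E `` {x}. \<Union>v\<in>tensor_rel scale emb E `` {y}. {formal_form emb q u v})"
    then obtain u v where "(x, u) \<in> tensor_rel scale emb E" "(y, v) \<in> tensor_rel scale emb E"
      "c = formal_form emb q u v" by blast
    then show "c \<in> {formal_form emb q x y}" using eq by simp
  qed
  then show ?thesis
    by (simp add: tensor_form_def)
qed

end

theory Submission
  imports Defs
begin

text \<open>
  Restricted to \<open>\<ell>\<close>, the two generators of the pencil become binary quadratic forms \<open>r\<close> and \<open>s\<close>.
  Write \<open>[p, q]\<close> for the determinant of two coordinate vectors and \<open>D\<close> for the resultant of \<open>r\<close>
  and \<open>s\<close>. Everything rests on a linear map \<open>T\<close> of the plane \<open>E\<close>, with trace \<open>0\<close> and entries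
  bilinear in the coefficients of \<open>r\<close> and \<open>s\<close>, that satisfies two polynomial identities
  (\<open>qval_wedge\<close> and \<open>conj_map_conj_map\<close>):
  \<open>r(p) s(q) - s(p) r(q) = [p, q] [T p, q]\<close> and \<open>T (T p) = D p\<close>.

  The left-hand side of the first identity is, as a form in \<open>q\<close>, the member of the pencil through \<open>p\<close>.
  The right-hand side says that its zeros are \<open>p\<close> and \<open>T p\<close>, so \<open>T\<close> sends a point to the other
  intersection of \<open>\<ell>\<close> with the quadric through that point. If \<open>D \<noteq> 0\<close>, the second identity makes
  \<open>T\<close> invertible and its projective map an involution; it is not the identity because a scalar matrix
  of trace \<open>0\<close> vanishes in characteristic other than \<open>2\<close>. This gives (A).

  The condition \<open>D \<noteq> 0\<close> links the three statements. If \<open>D = 0\<close>, then \<open>T p = 0\<close> for some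
  \<open>p \<noteq> 0\<close>, and the first identity shows that \<open>s(p) r - r(p) s\<close> vanishes on \<open>\<ell>\<close>: either
  \<open>p\<close> is a common zero, or a quadric of the pencil contains \<open>\<ell>\<close>. So (B) implies \<open>D \<noteq> 0\<close>.
  If \<open>D \<noteq> 0\<close>, the first identity excludes common zeros of \<open>r\<close> and \<open>s\<close>, and this argument is valid
  over every extension field, which gives (C) for the two generators.

  (A) implies (B) by counting: \<open>\<ell>\<close> has three points, so it is not of the form \<open>{P, \<sigma> P}\<close>,
  and if \<open>P\<close> were a common zero, then the quadric through a point other than \<open>P\<close> and \<open>\<sigma> P\<close>
  would meet \<open>\<ell>\<close> in a set that contains \<open>P\<close>, hence equals \<open>{P, \<sigma> P}\<close>, and yet contains
  a third point. Finally (C) implies (B): a common zero persists over \<open>L\<close>, and if a quadric of the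
  pencil contains \<open>\<ell>\<close>, all the others cut out the same form on \<open>\<ell>\<close> up to scalars, which
  has a zero over \<open>L\<close>.
\<close>

section \<open>Binary quadratic forms\<close>

fun qval :: "'a::comm_ring_1 \<times> 'a \<times> 'a \<Rightarrow> 'a \<times> 'a \<Rightarrow> 'a" where
  "qval (a, b, c) (x, y) = a * x^2 + 2 * b * x * y + c * y^2"

definition wedge :: "'a::comm_ring_1 \<times> 'a \<Rightarrow> 'a \<times> 'a \<Rightarrow> 'a" where
  "wedge p q = fst p * snd q - snd p * fst q"

text \<open>
  For independent generators, two points are the zeros of a member of the pencil if and only if the product of the linear forms
  that vanish at them, as a vector of three coefficients, is orthogonal to the cross product of the
  coefficient vectors of the generators. For a given first point this is a linear equation
  in the second one; the formula below is its solution, unique up to scalars when the resultant is non-zero.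
\<close>

fun conj_map :: "'a::comm_ring_1 \<times> 'a \<times> 'a \<Rightarrow> 'a \<times> 'a \<times> 'a \<Rightarrow> 'a \<times> 'a \<Rightarrow> 'a \<times> 'a" where
  "conj_map (a, b, c) (a', b', c') (x, y) =
     ((a * c' - c * a') * x + 2 * (b * c' - c * b') * y,
      - 2 * (a * b' - b * a') * x - (a * c' - c * a') * y)"

fun resultant :: "'a::comm_ring_1 \<times> 'a \<times> 'a \<Rightarrow> 'a \<times> 'a \<times> 'a \<Rightarrow> 'a" where
  "resultant (a, b, c) (a', b', c') = (a * c' - c * a')^2 - 4 * (a * b' - b * a') * (b * c' - c * b')"

text \<open>
  Where it comes from: as a form in \<open>q\<close>, the left-hand side vanishes at \<open>p\<close>, so the
  linear form \<open>wedge p q\<close> divides it, and \<open>conj_map\<close> gives the other factor.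
\<close>

lemma qval_wedge:
  "qval r p * qval s q - qval s p * qval r q = wedge p q * wedge (conj_map r s p) q"
  by (cases r; cases s; cases p; cases q) (simp add: wedge_def algebra_simps power2_eq_square)

text \<open>
  This is the theorem of Cayley and Hamilton for a map of trace \<open>0\<close>, whose determinant is
  the negative of the resultant.
\<close>

lemma conj_map_conj_map:
  "conj_map r s (conj_map r s p) = (resultant r s * fst p, resultant r s * snd p)"
  by (cases r; cases s; cases p) (simp add: algebra_simps power2_eq_square)

lemma conj_map_add:
  "conj_map r s (fst p + fst q, snd p + snd q) =
     (fst (conj_map r s p) + fst (conj_map r s q), snd (conj_map r s p) + snd (conj_map r s q))"
  by (cases r; cases s; cases p; cases q) (simp add: algebra_simps)

lemma conj_map_scale:
  "conj_map r s (c * fst p, c * snd p) = (c * fst (conj_map r s p), c * snd (conj_map r s p))"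
  by (cases r; cases s; cases p) (simp add: algebra_simps)

lemma conj_map_zero [simp]: "conj_map r s (0, 0) = (0, 0)"
  by (cases r; cases s) simp

lemma conj_map_nonzero:
  fixes r s :: "'a::field \<times> 'a \<times> 'a"
  assumes "resultant r s \<noteq> 0" "p \<noteq> (0, 0)"
  shows "conj_map r s p \<noteq> (0, 0)"
  using conj_map_conj_map[of r s p] assms by (cases p) auto

text \<open>
  At a common zero \<open>p\<close> the product of \<open>wedge p q\<close> and \<open>wedge (conj_map r s p) q\<close> would vanish
  for all \<open>q\<close>, although both are non-zero linear forms in \<open>q\<close>. The field is arbitrary because the lemma
  serves over the base field and over its algebraic closure.
\<close>

lemma no_common_zero:
  fixes r s :: "'a::field \<times> 'a \<times> 'a"
  assumes resultant: "resultant r s \<noteq> 0" and p: "p \<noteq> (0, 0)"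
  shows "qval r p \<noteq> 0 \<or> qval s p \<noteq> 0"
proof (rule ccontr)
  assume "\<not> ?thesis"
  then have zero: "wedge p q * wedge (conj_map r s p) q = 0" for q
    using qval_wedge[of r p s q] by simp
  obtain x y where xy: "p = (x, y)" by (cases p)
  obtain x' y' where xy': "conj_map r s p = (x', y')" by (cases "conj_map r s p")
  have nz: "(x', y') \<noteq> (0, 0)"
    using conj_map_nonzero[OF resultant p] xy' by simp
  show False
  proof (cases "wedge p (conj_map r s p) = 0")
    case False
    \<comment> \<open>The sum of two independent vectors is parallel to neither of them.\<close>
    moreover have "wedge p (x + x', y + y') = wedge p (conj_map r s p)"
      "wedge (conj_map r s p) (x + x', y + y') = - wedge p (conj_map r s p)"
      unfolding xy' by (simp_all add: xy wedge_def algebra_simps)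
    ultimately show False
      using zero[of "(x + x', y + y')"] by simp
  next
    case True
    then have "x * y' = y * x'" unfolding xy' by (simp add: xy wedge_def)
    moreover have "y * y' = 0" "x * x' = 0"
      using zero[of "(1, 0)"] zero[of "(0, 1)"] unfolding xy' by (simp_all add: wedge_def xy)
    ultimately show False using nz p xy by auto
  qed
qed

text \<open>
  The point is a kernel vector of \<open>conj_map r s\<close>, which exists because the square of that map is
  multiplication by the resultant. If \<open>r\<close> and \<open>s\<close> both vanish at \<open>p\<close>, it is a common zero; otherwise
  the conclusion is a non-trivial linear relation between \<open>r\<close> and \<open>s\<close>.
\<close>

lemma dependent_or_common_zero:
  fixes r s :: "'a::field \<times> 'a \<times> 'a"
  assumes "resultant r s = 0"
  obtains p where "p \<noteq> (0, 0)" "\<And>q. qval r p * qval s q = qval s p * qval r q"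
proof -
  have "\<exists>p. p \<noteq> (0, 0) \<and> conj_map r s p = (0, 0)"
  proof (cases "conj_map r s (1, 0) = (0, 0)")
    case False
    then show ?thesis using conj_map_conj_map[of r s "(1, 0)"] assms
      by (intro exI[of _ "conj_map r s (1, 0)"]) simp
  qed (intro exI[of _ "(1, 0)"], simp)
  then obtain p where "p \<noteq> (0, 0)" "conj_map r s p = (0, 0)" by blast
  then show thesis using that[of p] qval_wedge[of r p s] by (simp add: wedge_def)
qed

text \<open>
  Since \<open>r\<close> and \<open>s\<close> do not both vanish at \<open>p\<close>, a member of the pencil through \<open>p\<close> is a non-zero
  multiple of \<open>s(p) r - r(p) s\<close>, whose factors are known from \<open>qval_wedge\<close>.
\<close>

lemma zeros_of_member:
  fixes r s :: "'a::field \<times> 'a \<times> 'a"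
  assumes "resultant r s \<noteq> 0" "p \<noteq> (0, 0)" "(a, b) \<noteq> (0, 0)"
    and zero: "a * qval r p + b * qval s p = 0"
  shows "a * qval r q + b * qval s q = 0 \<longleftrightarrow> wedge p q = 0 \<or> wedge (conj_map r s p) q = 0"
proof -
  obtain k where k: "k \<noteq> 0" "a = k * qval s p" "b = - k * qval r p"
  proof (cases "qval s p = 0")
    case True
    with no_common_zero[OF assms(1,2)] have "qval r p \<noteq> 0" by blast
    with True zero assms(3) show thesis
      by (intro that[of "- b / qval r p"]) auto
  next
    case False
    with zero have "b = - a * qval r p / qval s p"
      by (simp add: field_simps eq_neg_iff_add_eq_0)
    with False assms(3) show thesis
      by (intro that[of "a / qval s p"]) auto
  qed
  have "a * qval r q + b * qval s q = - k * (qval r p * qval s q - qval s p * qval r q)"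
    by (simp add: k algebra_simps)
  with \<open>k \<noteq> 0\<close> show ?thesis by (simp add: qval_wedge)
qed

text \<open>
  The quadratic form \<open>wedge p (conj_map r s p)\<close> is, up to a scalar factor, the Jacobian of \<open>r\<close>
  and \<open>s\<close>. If it vanished at \<open>(1, 0)\<close>, \<open>(0, 1)\<close> and \<open>(1, 1)\<close>, then all the \<open>2 \<times> 2\<close> minors of
  the coefficients, and with them the resultant, would vanish.
\<close>

lemma conj_map_moves_point:
  fixes r s :: "'a::field \<times> 'a \<times> 'a"
  assumes "(2::'a) \<noteq> 0" "resultant r s \<noteq> 0"
  obtains p where "p \<noteq> (0, 0)" "wedge p (conj_map r s p) \<noteq> 0"
proof -
  obtain a b c a' b' c' where rs: "r = (a, b, c)" "s = (a', b', c')" by (cases r; cases s)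
  have "\<exists>p \<in> {(1, 0), (0, 1), (1, 1)}. wedge p (conj_map r s p) \<noteq> 0"
  proof (rule ccontr)
    assume "\<not> ?thesis"
    then have z: "wedge (1, 0) (conj_map r s (1, 0)) = 0" "wedge (0, 1) (conj_map r s (0, 1)) = 0"
      "wedge (1, 1) (conj_map r s (1, 1)) = 0" by auto
    have A: "a * b' - b * a' = 0" and C: "b * c' - c * b' = 0"
      using z(1,2) assms(1) by (simp_all add: rs wedge_def)
    have "2 * (a * c' - c * a') = 0"
      using z(3) A C by (auto simp: rs wedge_def mult.commute)
    then have "a * c' - c * a' = 0" using assms(1) mult_eq_0_iff[of 2 "a * c' - c * a'"] by blast
    with A C assms(2) show False by (simp add: rs)
  qed
  then obtain p where "p \<in> {(1, 0), (0, 1), (1, 1)}" "wedge p (conj_map r s p) \<noteq> 0" by blast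
  then show thesis using that[of p] by (elim insertE) simp_all
qed

lemma qval_has_zero:
  fixes r :: "'a::alg_closed_field \<times> 'a \<times> 'a"
  obtains p where "p \<noteq> (0, 0)" "qval r p = 0"
proof -
  obtain a b c where r: "r = (a, b, c)" by (cases r)
  show thesis
  proof (cases "a = 0")
    case True
    then show thesis using that[of "(1, 0)"] by (simp add: r)
  next
    case False
    then obtain x where "poly [:c, 2 * b, a:] x = 0"
      using alg_closed_imp_poly_has_root[of "[:c, 2 * b, a:]"] by auto
    then show thesis
      using that[of "(x, 1)"] by (simp add: r power2_eq_square algebra_simps)
  qed
qed


section \<open>Coordinates on the line\<close>

locale plane_basis = vector_space scale
  for scale :: "'k::field \<Rightarrow> 'v::ab_group_add \<Rightarrow> 'v" +
  fixes E :: "'v set" and e1 e2 :: 'v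
  assumes E_eq: "E = {scale x e1 + scale y e2 | x y. True}"
    and basis_indep: "scale x e1 + scale y e2 = 0 \<Longrightarrow> x = 0 \<and> y = 0"
begin

definition vec :: "'k \<times> 'k \<Rightarrow> 'v" where
  "vec p = scale (fst p) e1 + scale (snd p) e2"

definition coords :: "'v \<Rightarrow> 'k \<times> 'k" where
  "coords = inv_into UNIV vec"

definition point :: "'v \<Rightarrow> 'v set" where
  "point v = {scale c v | c. True}"

definition form_coefs :: "('v \<Rightarrow> 'v \<Rightarrow> 'k) \<Rightarrow> 'k \<times> 'k \<times> 'k" where
  "form_coefs q = (q e1 e1, q e1 e2, q e2 e2)"

lemma vec_add: "vec p + vec q = vec (fst p + fst q, snd p + snd q)"
  by (simp add: vec_def scale_left_distrib)

lemma vec_scale: "scale c (vec p) = vec (c * fst p, c * snd p)"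
  by (simp add: vec_def scale_right_distrib)

lemma vec_eq_0: "vec p = 0 \<longleftrightarrow> p = (0, 0)"
  using basis_indep[of "fst p" "snd p"] by (cases p) (auto simp: vec_def)

lemma vec_inject: "vec p = vec q \<longleftrightarrow> p = q"
proof
  assume eq: "vec p = vec q"
  have "vec (fst p - fst q, snd p - snd q) = vec p - vec q"
    by (simp add: vec_def scale_left_diff_distrib)
  with eq show "p = q" by (simp add: vec_eq_0 prod_eq_iff)
qed simp

lemma coords_vec [simp]: "coords (vec p) = p"
  unfolding coords_def by (rule inv_into_f_f) (auto simp: inj_def vec_inject)

lemma vec_in_E [simp]: "vec p \<in> E"
  by (auto simp: E_eq vec_def)

lemma E_range: "E = range vec"
  unfolding E_eq vec_def image_def by (auto intro!: Collect_cong)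

lemma vec_basis: "vec (1, 0) = e1" "vec (0, 1) = e2"
  by (simp_all add: vec_def)

lemma coords_basis [simp]: "coords e1 = (1, 0)" "coords e2 = (0, 1)"
  using coords_vec[of "(1, 0)"] coords_vec[of "(0, 1)"] by (simp_all only: vec_basis)

lemma basis_in_E [simp]: "e1 \<in> E" "e2 \<in> E"
  using vec_in_E[of "(1, 0)"] vec_in_E[of "(0, 1)"] by (simp_all only: vec_basis)

lemma basis_distinct: "e1 \<noteq> e2"
  using vec_inject[of "(1, 0)" "(0, 1)"] by (simp add: vec_basis)

lemma proj_space_E: "proj_space scale 0 E = {point (vec p) | p. p \<noteq> (0, 0)}"
  unfolding proj_space_def E_range point_def using vec_eq_0 by blast

lemma point_vec_eq:
  assumes "p \<noteq> (0, 0)" "q \<noteq> (0, 0)"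
  shows "point (vec p) = point (vec q) \<longleftrightarrow> wedge p q = 0"
proof
  assume "point (vec p) = point (vec q)"
  moreover have "vec p \<in> point (vec p)" unfolding point_def by (metis (mono_tags, lifting) mem_Collect_eq scale_one)
  ultimately obtain c where "vec p = scale c (vec q)" by (auto simp: point_def)
  then have "p = (c * fst q, c * snd q)" by (simp add: vec_scale vec_inject)
  then show "wedge p q = 0" by (simp add: wedge_def)
next
  assume w: "wedge p q = 0"
  obtain x y x' y' where xy: "p = (x, y)" "q = (x', y')" by (cases p; cases q)
  have w': "x * y' = y * x'" using w by (simp add: wedge_def xy)
  obtain c where c: "c \<noteq> 0" "p = (c * fst q, c * snd q)"
  proof (cases "x' = 0")
    case True
    then show thesis using assms w' xy by (intro that[of "y / y'"]) auto
  next
    case False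
    then show thesis using assms w' xy by (intro that[of "x / x'"]) (auto simp: field_simps)
  qed
  have "scale d (vec p) = scale (d * c) (vec q)" for d
    by (simp add: c(2) vec_scale mult.assoc)
  moreover have "scale d (vec q) = scale (d / c) (vec p)" for d
    using c(1) by (simp add: c(2) vec_scale)
  ultimately show "point (vec p) = point (vec q)"
    unfolding point_def by blast
qed

text \<open>
  These three points exist over every field; the bound is what separates the whole line from a
  pair of conjugate points.
\<close>

lemma three_points:
  obtains p1 p2 p3 where "p1 \<in> proj_space scale 0 E" "p2 \<in> proj_space scale 0 E"
    "p3 \<in> proj_space scale 0 E" "p1 \<noteq> p2" "p2 \<noteq> p3" "p1 \<noteq> p3"
proof (rule that[of "point (vec (1, 0))" "point (vec (0, 1))" "point (vec (1, 1))"])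
  have "point (vec p) \<in> proj_space scale 0 E" if "p \<noteq> (0, 0)" for p
    using that unfolding proj_space_E by blast
  then show "point (vec (1, 0)) \<in> proj_space scale 0 E" "point (vec (0, 1)) \<in> proj_space scale 0 E"
    "point (vec (1, 1)) \<in> proj_space scale 0 E" by simp_all
qed (simp_all add: point_vec_eq wedge_def)

lemma form_vec:
  assumes "sym_bilinear scale q"
  shows "q (vec p) (vec p) = qval (form_coefs q) p"
proof -
  have sym: "q x y = q y x" for x y
    using assms by (simp add: sym_bilinear_def)
  have right: "q u (v + w) = q u v + q u w" "q u (scale c v) = c * q u v" for c u v w
    using sym_bilinear_left[OF assms] sym by metis+
  show ?thesis
    by (cases p) (simp add: vec_def form_coefs_def sym_bilinear_left[OF assms] right sym[of e2 e1]
        power2_eq_square algebra_simps)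
qed

lemma sym_bilinear_combination:
  assumes "sym_bilinear scale q" "sym_bilinear scale q'"
  shows "sym_bilinear scale (\<lambda>x y. a * q x y + b * q' x y)"
  using assms by (auto simp: sym_bilinear_def Vector_Spaces.linear_iff algebra_simps)

lemma quadric_points_point:
  assumes "sym_bilinear scale q" "p \<noteq> (0, 0)"
  shows "point (vec p) \<in> quadric_points scale (quadric q) \<longleftrightarrow> qval (form_coefs q) p = 0"
proof -
  have "point (vec p) \<in> proj_space scale 0 UNIV"
    using assms(2) by (auto simp: proj_space_def point_def vec_eq_0)
  moreover have "(\<exists>f\<in>quadric q. \<exists>v\<in>point (vec p). v \<noteq> 0 \<and> f v v = 0) \<longleftrightarrow> qval (form_coefs q) p = 0"
  proof
    assume "\<exists>f\<in>quadric q. \<exists>v\<in>point (vec p). v \<noteq> 0 \<and> f v v = 0"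
    then obtain c d where "c \<noteq> 0" "scale d (vec p) \<noteq> 0" "c * q (scale d (vec p)) (scale d (vec p)) = 0"
      by (auto simp: quadric_def point_def)
    moreover have "qval (form_coefs q) (d * fst p, d * snd p) = d^2 * qval (form_coefs q) p"
      by (cases p; cases "form_coefs q") (simp add: algebra_simps power2_eq_square)
    ultimately show "qval (form_coefs q) p = 0"
      by (auto simp: vec_scale form_vec[OF assms(1)] vec_eq_0)
  next
    assume z: "qval (form_coefs q) p = 0"
    have "q \<in> quadric q" unfolding quadric_def by (auto intro!: exI[of _ 1])
    moreover have "vec p \<in> point (vec p)"
      unfolding point_def by (metis (mono_tags, lifting) mem_Collect_eq scale_one)
    ultimately show "\<exists>f\<in>quadric q. \<exists>v\<in>point (vec p). v \<noteq> 0 \<and> f v v = 0"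
      using z assms by (intro bexI[of _ q] bexI[of _ "vec p"]) (auto simp: vec_eq_0 form_vec)
  qed
  ultimately show ?thesis by (simp add: quadric_points_def)
qed

end


section \<open>Extension of scalars\<close>

locale plane_ext = plane_basis scale E e1 e2 + alg_closure_embedding emb
  for scale :: "'k::field \<Rightarrow> 'v::ab_group_add \<Rightarrow> 'v" and E e1 e2
    and emb :: "'k \<Rightarrow> 'l::alg_closed_field"
begin

definition emb_coefs :: "'k \<times> 'k \<times> 'k \<Rightarrow> 'l \<times> 'l \<times> 'l" where
  "emb_coefs r = (case r of (a, b, c) \<Rightarrow> (emb a, emb b, emb c))"

definition formal_vec :: "'l \<times> 'l \<Rightarrow> 'v \<Rightarrow>\<^sub>0 'l" where
  "formal_vec p = Poly_Mapping.single e1 (fst p) + Poly_Mapping.single e2 (snd p)"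

definition tensor_vec :: "'l \<times> 'l \<Rightarrow> ('v \<Rightarrow>\<^sub>0 'l) set" where
  "tensor_vec p = tensor_rel scale emb E `` {formal_vec p}"

lemma emb_0 [simp]: "emb 0 = 0"
  using hom_add[of 0 0] by (metis add_0_left add_cancel_right_left)

lemma emb_diff: "emb (a - b) = emb a - emb b"
  using hom_add[of "a - b" b] by (simp add: algebra_simps)

lemma emb_eq_0 [simp]: "emb a = 0 \<longleftrightarrow> a = 0"
proof
  assume "emb a = 0"
  then show "a = 0" using hom_mult[of a "inverse a"] hom_one by (cases "a = 0") auto
qed simp

lemma resultant_emb: "resultant (emb_coefs r) (emb_coefs s) = emb (resultant r s)"
proof -
  have two: "emb 2 = 2" using hom_add[of 1 1] by (simp add: hom_one)
  have "emb 4 = 4" using hom_add[of 2 2] by (simp add: two)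
  then show ?thesis
    by (cases r; cases s) (simp add: emb_coefs_def emb_diff hom_mult power2_eq_square)
qed

lemma qval_emb: "qval (emb_coefs r) (emb x, emb y) = emb (qval r (x, y))"
proof -
  have "emb 2 = 2" using hom_add[of 1 1] by (simp add: hom_one)
  then show ?thesis
    by (cases r) (simp add: emb_coefs_def hom_add hom_mult power2_eq_square)
qed

lemma formal_vec_formal: "formal_vec p \<in> formal_tensors E"
proof -
  have "Poly_Mapping.single e1 (fst p) \<in> formal_tensors E"
    "Poly_Mapping.single e2 (snd p) \<in> formal_tensors E"
    by (simp_all add: formal_tensors_def)
  then show ?thesis
    using Poly_Mapping.keys_add[of "Poly_Mapping.single e1 (fst p)" "Poly_Mapping.single e2 (snd p)"]
    unfolding formal_tensors_def formal_vec_def by blast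
qed

text \<open>
  The symbol \<open>(x e\<^sub>1 + y e\<^sub>2) \<otimes> a\<close> is reduced to the symbols of the basis in three steps: one use of
  additivity and one of homogeneity for each basis vector.
\<close>

lemma single_vec_reduce:
  "Poly_Mapping.single (vec p) a - formal_vec (emb (fst p) * a, emb (snd p) * a) \<in> tensor_null scale emb E"
proof -
  let ?N = "tensor_null scale emb E"
  let ?u = "scale (fst p) e1" and ?w = "scale (snd p) e2"
  have E: "e1 \<in> E" "e2 \<in> E" "?u \<in> E" "?w \<in> E"
    using vec_in_E[of "(fst p, 0)"] vec_in_E[of "(0, snd p)"] by (simp_all add: vec_def)
  have "Poly_Mapping.single (?u + ?w) a - Poly_Mapping.single ?u a - Poly_Mapping.single ?w a \<in> ?N"
    by (rule tensor_null.add[OF E(3,4)])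
  moreover have "Poly_Mapping.single ?u a - Poly_Mapping.single e1 (emb (fst p) * a) \<in> ?N"
    by (rule tensor_null.scale[OF E(1)])
  moreover have "Poly_Mapping.single ?w a - Poly_Mapping.single e2 (emb (snd p) * a) \<in> ?N"
    by (rule tensor_null.scale[OF E(2)])
  ultimately have "(Poly_Mapping.single (?u + ?w) a - Poly_Mapping.single ?u a - Poly_Mapping.single ?w a) +
     ((Poly_Mapping.single ?u a - Poly_Mapping.single e1 (emb (fst p) * a)) +
      (Poly_Mapping.single ?w a - Poly_Mapping.single e2 (emb (snd p) * a))) \<in> ?N"
    by (intro tensor_null_add)
  then show ?thesis by (simp add: formal_vec_def vec_def algebra_simps)
qed

lemma formal_tensor_reduce:
  assumes "x \<in> formal_tensors E"
  obtains p where "x - formal_vec p \<in> tensor_null scale emb E"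
proof -
  have "\<exists>p. (\<Sum>v\<in>A. Poly_Mapping.single v (Poly_Mapping.lookup x v)) - formal_vec p \<in> tensor_null scale emb E"
    if "finite A" "A \<subseteq> E" for A
    using that
  proof (induction A rule: finite_induct)
    case empty
    show ?case by (rule exI[of _ "(0, 0)"]) (simp add: formal_vec_def tensor_null.zero)
  next
    case (insert v A)
    then obtain p where p: "(\<Sum>v\<in>A. Poly_Mapping.single v (Poly_Mapping.lookup x v)) - formal_vec p \<in> tensor_null scale emb E"
      by auto
    obtain w where "v = vec w" using insert.prems by (auto simp: E_range)
    with single_vec_reduce obtain q
      where q: "Poly_Mapping.single v (Poly_Mapping.lookup x v) - formal_vec q \<in> tensor_null scale emb E" by blast
    have "formal_vec q + formal_vec p = formal_vec (fst q + fst p, snd q + snd p)"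
      by (simp add: formal_vec_def single_add algebra_simps)
    then show ?case
      using tensor_null_add[OF q p] insert.hyps
      by (intro exI[of _ "(fst q + fst p, snd q + snd p)"]) (simp add: algebra_simps)
  qed
  moreover have "(\<Sum>v\<in>Poly_Mapping.keys x. Poly_Mapping.single v (Poly_Mapping.lookup x v)) = x"
    by (rule poly_mapping_eqI) (simp add: lookup_sum lookup_single when_def in_keys_iff)
  ultimately show thesis
    using assms that[of p for p] finite_keys[of x] unfolding formal_tensors_def
    by (metis (mono_tags, lifting) mem_Collect_eq)
qed

text \<open>
  That \<open>e\<^sub>1 \<otimes> 1\<close> and \<open>e\<^sub>2 \<otimes> 1\<close> are independent over \<open>L\<close> is seen by extending the two coordinate
  functions of \<open>E\<close> to \<open>L\<close>-linear functions of formal sums, which kill the tensor relations.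
\<close>

lemma formal_vec_null_iff: "formal_vec p \<in> tensor_null scale emb E \<longleftrightarrow> p = (0, 0)"
proof
  assume null: "formal_vec p \<in> tensor_null scale emb E"
  \<comment> \<open>A linear function is a bilinear form that ignores its second argument, so the rules for
    \<open>formal_form\<close> apply to it; pairing with \<open>0 \<otimes> 1\<close> only serves to fill that argument.\<close>
  define ev where "ev c x = formal_form emb (\<lambda>v _. c (coords v)) x (Poly_Mapping.single 0 1)"
    for c :: "'k \<times> 'k \<Rightarrow> 'k" and x
  have ev_diff: "ev c (x - y) = ev c x - ev c y" for c x y
    by (simp add: ev_def formal_form_diff_left)
  have ev_single: "ev c (Poly_Mapping.single v a) = a * emb (c (coords v))" for c v a
    by (simp add: ev_def formal_form_single)
  have ev_null: "ev c x = 0"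
    if x: "x \<in> tensor_null scale emb E" and c: "c = fst \<or> c = snd" for c x
    using x
  proof (induction rule: tensor_null.induct)
    case zero
    show ?case using ev_diff[of c 0 0] by simp
  next
    case (add v w a)
    then show ?case
      using c by (auto simp: ev_diff ev_single E_range vec_add hom_add distrib_left)
  next
    case (scale v d a)
    then show ?case
      using c by (auto simp: ev_diff ev_single E_range vec_scale hom_mult mult_ac)
  qed (simp add: ev_diff)
  have "Poly_Mapping.single e1 (fst p) = formal_vec p - Poly_Mapping.single e2 (snd p)"
    by (simp add: formal_vec_def)
  then have "ev c (Poly_Mapping.single e1 (fst p)) = ev c (formal_vec p) - ev c (Poly_Mapping.single e2 (snd p))" for c
    by (simp add: ev_diff)
  then have "ev c (formal_vec p) = fst p * emb (c (1, 0)) + snd p * emb (c (0, 1))" for c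
    by (simp add: ev_single algebra_simps)
  with ev_null[OF null, of fst] ev_null[OF null, of snd] show "p = (0, 0)"
    by (simp add: hom_one prod_eq_iff)
qed (simp add: formal_vec_def tensor_null.zero)

lemma tensor_eq: "tensor scale emb E = range tensor_vec"
proof
  show "tensor scale emb E \<subseteq> range tensor_vec"
  proof
    fix X assume "X \<in> tensor scale emb E"
    then obtain x where x: "x \<in> formal_tensors E" "X = tensor_rel scale emb E `` {x}"
      by (auto simp: tensor_def quotient_def)
    obtain p where "x - formal_vec p \<in> tensor_null scale emb E" using formal_tensor_reduce[OF x(1)] .
    then have "(x, formal_vec p) \<in> tensor_rel scale emb E"
      using x(1) formal_vec_formal by (simp add: tensor_rel_def)
    then have "X = tensor_vec p"
      unfolding x(2) tensor_vec_def by (rule equiv_class_eq[OF equiv_tensor_rel])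
    then show "X \<in> range tensor_vec" by blast
  qed
  show "range tensor_vec \<subseteq> tensor scale emb E"
    unfolding tensor_def tensor_vec_def using quotientI[OF formal_vec_formal] by blast
qed

lemma tensor_vec_eq_zero: "tensor_vec p = tensor_zero scale emb E \<longleftrightarrow> p = (0, 0)"
proof -
  have zero: "(0 :: 'v \<Rightarrow>\<^sub>0 'l) \<in> formal_tensors E" by (simp add: formal_tensors_def)
  have "tensor_vec p = tensor_zero scale emb E \<longleftrightarrow> (formal_vec p, 0) \<in> tensor_rel scale emb E"
    unfolding tensor_vec_def tensor_zero_def
    by (rule eq_equiv_class_iff[OF equiv_tensor_rel formal_vec_formal zero])
  then show ?thesis
    using formal_vec_formal zero by (simp add: tensor_rel_def formal_vec_null_iff)
qed

lemma tensor_vec_smult: "tensor_smult scale emb E c (tensor_vec p) = tensor_vec (c * fst p, c * snd p)"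
proof -
  have "Poly_Mapping.map ((*) c) (formal_vec p) = formal_vec (c * fst p, c * snd p)"
    using basis_distinct by (intro poly_mapping_eqI)
      (auto simp: formal_vec_def Poly_Mapping.map.rep_eq lookup_add lookup_single when_def)
  then show ?thesis
    by (simp add: tensor_vec_def tensor_smult_class[OF formal_vec_formal])
qed

lemma tensor_form_tensor_vec:
  assumes "sym_bilinear scale q"
  shows "tensor_form emb q (tensor_vec p) (tensor_vec p) = qval (emb_coefs (form_coefs q)) p"
proof -
  have sym: "q e2 e1 = q e1 e2" using assms by (simp add: sym_bilinear_def)
  have keys: "Poly_Mapping.keys (formal_vec p) \<subseteq> {e1, e2}"
    by (auto simp: formal_vec_def in_keys_iff lookup_add lookup_single when_def split: if_splits)
  have "tensor_form emb q (tensor_vec p) (tensor_vec p) = formal_form emb q (formal_vec p) (formal_vec p)"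
    unfolding tensor_vec_def
    by (rule tensor_form_class[OF _ assms formal_vec_formal formal_vec_formal]) (rule alg_closure_embedding_axioms)
  also have "\<dots> = (\<Sum>v\<in>{e1, e2}. \<Sum>w\<in>{e1, e2}.
      Poly_Mapping.lookup (formal_vec p) v * Poly_Mapping.lookup (formal_vec p) w * emb (q v w))"
    by (rule formal_form_superset[OF _ keys _ keys]) simp_all
  also have "\<dots> = qval (emb_coefs (form_coefs q)) p"
    using basis_distinct by (cases p) (simp add: formal_vec_def lookup_add
        lookup_single emb_coefs_def form_coefs_def sym power2_eq_square algebra_simps)
  finally show ?thesis .
qed

definition tensor_point :: "('v \<Rightarrow>\<^sub>0 'l) set \<Rightarrow> ('v \<Rightarrow>\<^sub>0 'l) set set" where
  "tensor_point X = {tensor_smult scale emb E c X | c. True}"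

lemma proj_space_ext: "proj_space (tensor_smult scale emb E) (tensor_zero scale emb E) (tensor scale emb E) =
    {tensor_point (tensor_vec p) | p. p \<noteq> (0, 0)}"
  unfolding proj_space_def tensor_eq tensor_point_def using tensor_vec_eq_zero by blast

lemma quadric_points_ext_point:
  assumes "sym_bilinear scale q" "p \<noteq> (0, 0)"
  shows "tensor_point (tensor_vec p) \<in> quadric_points_ext scale emb E (quadric q) \<longleftrightarrow> qval (emb_coefs (form_coefs q)) p = 0"
proof -
  have "(\<exists>f\<in>quadric q. \<exists>X\<in>tensor_point (tensor_vec p). X \<noteq> tensor_zero scale emb E \<and> tensor_form emb f X X = 0)
      \<longleftrightarrow> qval (emb_coefs (form_coefs q)) p = 0"
  proof
    assume "\<exists>f\<in>quadric q. \<exists>X\<in>tensor_point (tensor_vec p). X \<noteq> tensor_zero scale emb E \<and> tensor_form emb f X X = 0"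
    then obtain c d where *: "c \<noteq> 0" "tensor_vec (d * fst p, d * snd p) \<noteq> tensor_zero scale emb E"
      "tensor_form emb (\<lambda>x y. c * q x y) (tensor_vec (d * fst p, d * snd p)) (tensor_vec (d * fst p, d * snd p)) = 0"
      by (auto simp: quadric_def tensor_point_def tensor_vec_smult)
    have "qval (emb_coefs (form_coefs (\<lambda>x y. c * q x y))) (d * fst p, d * snd p) = emb c * d^2 * qval (emb_coefs (form_coefs q)) p"
      by (cases p) (simp add: emb_coefs_def form_coefs_def hom_mult algebra_simps power2_eq_square)
    then show "qval (emb_coefs (form_coefs q)) p = 0"
      using * by (auto simp add: tensor_form_tensor_vec sym_bilinear_combination[OF assms(1) assms(1), of c 0, simplified] tensor_vec_eq_zero)
  next
    assume z: "qval (emb_coefs (form_coefs q)) p = 0"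
    have "q \<in> quadric q" unfolding quadric_def by (auto intro!: exI[of _ 1])
    moreover have "tensor_vec p \<in> tensor_point (tensor_vec p)"
      using tensor_vec_smult[of 1 p] unfolding tensor_point_def by (metis (mono_tags, lifting) mem_Collect_eq mult_1 prod.collapse)
    ultimately show "\<exists>f\<in>quadric q. \<exists>X\<in>tensor_point (tensor_vec p). X \<noteq> tensor_zero scale emb E \<and> tensor_form emb f X X = 0"
      using z assms by (intro bexI[of _ q] bexI[of _ "tensor_vec p"]) (auto simp: tensor_vec_eq_zero tensor_form_tensor_vec)
  qed
  moreover have "tensor_point (tensor_vec p) \<in> {tensor_point (tensor_vec p) | p. p \<noteq> (0, 0)}"
    using assms(2) by blast
  ultimately show ?thesis
    by (simp only: quadric_points_ext_def proj_space_ext mem_Collect_eq simp_thms)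
qed

end


section \<open>The pencil on the line\<close>

locale pencil_on_line = plane_ext scale E e1 e2 emb
  for scale :: "'k::field \<Rightarrow> 'v::ab_group_add \<Rightarrow> 'v" and E e1 e2
    and emb :: "'k \<Rightarrow> 'l::alg_closed_field" +
  fixes R S :: "'v \<Rightarrow> 'v \<Rightarrow> 'k"
  assumes two_nonzero: "(2::'k) \<noteq> 0"
    and sym_R: "sym_bilinear scale R" and sym_S: "sym_bilinear scale S"
    and indep_forms: "independent_forms R S"
begin

abbreviation line :: "'v set set" where
  "line \<equiv> proj_space scale 0 E"

abbreviation resultant_RS :: 'k where
  "resultant_RS \<equiv> resultant (form_coefs R) (form_coefs S)"

definition member :: "'k \<Rightarrow> 'k \<Rightarrow> ('v \<Rightarrow> 'v \<Rightarrow> 'k) set" where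
  "member a b = quadric (\<lambda>x y. a * R x y + b * S x y)"

lemma pencil_eq: "pencil R S = {member a b | a b. (a, b) \<noteq> (0, 0)}"
  by (simp add: pencil_def member_def)

lemma member_in_pencil: "(a, b) \<noteq> (0, 0) \<Longrightarrow> member a b \<in> pencil R S"
  unfolding pencil_eq by blast

lemma member_points:
  assumes "p \<noteq> (0, 0)"
  shows "point (vec p) \<in> quadric_points scale (member a b) \<longleftrightarrow>
    a * qval (form_coefs R) p + b * qval (form_coefs S) p = 0"
proof -
  have "qval (form_coefs (\<lambda>x y. a * R x y + b * S x y)) p = a * qval (form_coefs R) p + b * qval (form_coefs S) p"
    by (cases p) (simp add: form_coefs_def algebra_simps)
  then show ?thesis
    unfolding member_def
    by (simp only: quadric_points_point[OF sym_bilinear_combination[OF sym_R sym_S] assms])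
qed

lemma member_points_ext:
  assumes "p \<noteq> (0, 0)"
  shows "tensor_point (tensor_vec p) \<in> quadric_points_ext scale emb E (member a b) \<longleftrightarrow>
    emb a * qval (emb_coefs (form_coefs R)) p + emb b * qval (emb_coefs (form_coefs S)) p = 0"
proof -
  have "qval (emb_coefs (form_coefs (\<lambda>x y. a * R x y + b * S x y))) p =
      emb a * qval (emb_coefs (form_coefs R)) p + emb b * qval (emb_coefs (form_coefs S)) p"
    by (cases p) (simp add: form_coefs_def emb_coefs_def hom_add hom_mult algebra_simps)
  then show ?thesis
    unfolding member_def
    by (simp only: quadric_points_ext_point[OF sym_bilinear_combination[OF sym_R sym_S] assms])
qed

definition line_in_member :: bool where
  "line_in_member \<longleftrightarrow> (\<exists>Q\<in>pencil R S. line \<subseteq> quadric_points scale Q)"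

definition base_point :: bool where
  "base_point \<longleftrightarrow> (\<exists>P\<in>line. \<forall>Q\<in>pencil R S. P \<in> quadric_points scale Q)"

definition swapped_by :: "('v set \<Rightarrow> 'v set) \<Rightarrow> bool" where
  "swapped_by \<sigma> \<longleftrightarrow> (\<forall>Q\<in>pencil R S. quadric_points scale Q \<inter> line \<noteq> {} \<longrightarrow>
     (\<exists>P\<in>line. quadric_points scale Q \<inter> line = {P, \<sigma> P}))"

lemma line_in_member_iff:
  "line_in_member \<longleftrightarrow> (\<exists>a b. (a, b) \<noteq> (0, 0) \<and>
     (\<forall>p. p \<noteq> (0, 0) \<longrightarrow> a * qval (form_coefs R) p + b * qval (form_coefs S) p = 0))"
proof -
  have "line \<subseteq> quadric_points scale (member a b) \<longleftrightarrow>
     (\<forall>p. p \<noteq> (0, 0) \<longrightarrow> a * qval (form_coefs R) p + b * qval (form_coefs S) p = 0)" for a b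
    unfolding proj_space_E using member_points by blast
  then show ?thesis unfolding line_in_member_def pencil_eq by blast
qed

lemma base_point_iff:
  "base_point \<longleftrightarrow> (\<exists>p. p \<noteq> (0, 0) \<and> qval (form_coefs R) p = 0 \<and> qval (form_coefs S) p = 0)"
proof -
  have "(\<forall>Q\<in>pencil R S. point (vec p) \<in> quadric_points scale Q) \<longleftrightarrow>
      qval (form_coefs R) p = 0 \<and> qval (form_coefs S) p = 0" if p: "p \<noteq> (0, 0)" for p
  proof
    assume all: "\<forall>Q\<in>pencil R S. point (vec p) \<in> quadric_points scale Q"
    show "qval (form_coefs R) p = 0 \<and> qval (form_coefs S) p = 0"
      using all member_in_pencil[of 1 0] member_in_pencil[of 0 1]
        member_points[OF p, of 1 0] member_points[OF p, of 0 1] by simp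
  next
    assume "qval (form_coefs R) p = 0 \<and> qval (form_coefs S) p = 0"
    then show "\<forall>Q\<in>pencil R S. point (vec p) \<in> quadric_points scale Q"
      using member_points[OF p] by (auto simp: pencil_eq)
  qed
  then show ?thesis unfolding base_point_def proj_space_E by blast
qed

lemma resultant_nonzero:
  assumes "\<not> line_in_member" "\<not> base_point"
  shows "resultant_RS \<noteq> 0"
proof
  assume "resultant_RS = 0"
  then obtain p where p: "p \<noteq> (0, 0)"
    and dep: "\<And>q. qval (form_coefs R) p * qval (form_coefs S) q = qval (form_coefs S) p * qval (form_coefs R) q"
    by (rule dependent_or_common_zero) blast
  show False
  proof (cases "qval (form_coefs R) p = 0 \<and> qval (form_coefs S) p = 0")
    case True
    with p assms(2) show False unfolding base_point_iff by blast
  next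
    case False
    then have "(qval (form_coefs S) p, - qval (form_coefs R) p) \<noteq> (0, 0)" by auto
    moreover have "qval (form_coefs S) p * qval (form_coefs R) q + - qval (form_coefs R) p * qval (form_coefs S) q = 0" for q
      using dep[of q] by simp
    ultimately show False using assms(1) unfolding line_in_member_iff by blast
  qed
qed

definition conj_fun :: "'v \<Rightarrow> 'v" where
  "conj_fun v = vec (conj_map (form_coefs R) (form_coefs S) (coords v))"

lemma conj_fun_vec: "conj_fun (vec p) = vec (conj_map (form_coefs R) (form_coefs S) p)"
  by (simp add: conj_fun_def)

lemma conj_fun_scale: "v \<in> E \<Longrightarrow> conj_fun (scale c v) = scale c (conj_fun v)"
  unfolding E_range by (erule rangeE) (simp add: vec_scale conj_fun_vec conj_map_scale)

lemma conj_fun_conj_fun: "v \<in> E \<Longrightarrow> conj_fun (conj_fun v) = scale resultant_RS v"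
  unfolding E_range by (erule rangeE) (simp add: vec_scale conj_fun_vec conj_map_conj_map)

lemma conj_fun_E: "conj_fun v \<in> E"
  by (simp add: conj_fun_def)

lemma linear_automorphism_conj_fun:
  assumes "resultant_RS \<noteq> 0"
  shows "linear_automorphism_on scale E conj_fun"
proof -
  have "conj_fun (x + y) = conj_fun x + conj_fun y" if xy: "x \<in> E" "y \<in> E" for x y
  proof -
    obtain p q where "x = vec p" "y = vec q" using xy unfolding E_range by blast
    then show ?thesis by (simp add: vec_add conj_fun_vec conj_map_add)
  qed
  moreover have "bij_betw conj_fun E E"
  proof (rule bij_betw_byWitness[where f' = "\<lambda>v. scale (inverse resultant_RS) (conj_fun v)"])
    show "(\<lambda>v. scale (inverse resultant_RS) (conj_fun v)) ` E \<subseteq> E"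
      by (auto simp: conj_fun_def vec_scale)
  qed (use assms in \<open>auto simp: conj_fun_E conj_fun_scale conj_fun_conj_fun\<close>)
  ultimately show ?thesis
    by (auto simp: linear_automorphism_on_def conj_fun_scale)
qed

lemma image_conj_fun_point: "conj_fun ` point (vec p) = point (vec (conj_map (form_coefs R) (form_coefs S) p))"
proof -
  have "conj_fun ` point (vec p) = {conj_fun (scale c (vec p)) | c. True}"
    unfolding point_def by blast
  then show ?thesis by (simp add: conj_fun_scale conj_fun_vec point_def)
qed

lemma involution_conj_fun:
  assumes "resultant_RS \<noteq> 0"
  shows "involution scale E ((`) conj_fun)"
  unfolding involution_def
proof (intro conjI ballI)
  show "projective_transformation scale E ((`) conj_fun)"
    using linear_automorphism_conj_fun[OF assms] by (auto simp: projective_transformation_def)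
next
  fix P assume "P \<in> line"
  then obtain p where p: "P = point (vec p)" "p \<noteq> (0, 0)" unfolding proj_space_E by blast
  have nz: "(resultant_RS * fst p, resultant_RS * snd p) \<noteq> (0, 0)"
    using p(2) assms by (cases p) simp
  have "point (vec (resultant_RS * fst p, resultant_RS * snd p)) = point (vec p)"
    unfolding point_vec_eq[OF nz p(2)] by (simp add: wedge_def)
  then show "conj_fun ` (conj_fun ` P) = P"
    by (simp add: p(1) image_conj_fun_point conj_map_conj_map)
next
  obtain p where p: "p \<noteq> (0, 0)" "wedge p (conj_map (form_coefs R) (form_coefs S) p) \<noteq> 0"
    using conj_map_moves_point[OF two_nonzero assms] .
  then have "point (vec p) \<noteq> conj_fun ` point (vec p)"
    using conj_map_nonzero[OF assms p(1)] by (simp add: image_conj_fun_point point_vec_eq)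
  moreover have "point (vec p) \<in> line" using p(1) unfolding proj_space_E by blast
  ultimately show "\<exists>P\<in>line. conj_fun ` P \<noteq> P" by metis
qed

text \<open>
  The pair for a quadric is read off from any one of its points \<open>p\<close> on the line: by
  \<open>zeros_of_member\<close> the others are all equal to the image of \<open>p\<close>.
\<close>

lemma swapped_by_conj_fun:
  assumes "resultant_RS \<noteq> 0"
  shows "swapped_by ((`) conj_fun)"
  unfolding swapped_by_def
proof (intro ballI impI)
  fix Q assume Q: "Q \<in> pencil R S" "quadric_points scale Q \<inter> line \<noteq> {}"
  then obtain a b where ab: "Q = member a b" "(a, b) \<noteq> (0, 0)" unfolding pencil_eq by blast
  from Q(2) obtain p where p: "p \<noteq> (0, 0)" "point (vec p) \<in> quadric_points scale Q"
    unfolding proj_space_E by blast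
  let ?p' = "conj_map (form_coefs R) (form_coefs S) p"
  have p': "?p' \<noteq> (0, 0)" by (rule conj_map_nonzero[OF assms p(1)])
  have zero: "a * qval (form_coefs R) p + b * qval (form_coefs S) p = 0"
    using p(2) member_points[OF p(1)] by (simp add: ab(1))
  have "point (vec q) \<in> quadric_points scale Q \<longleftrightarrow> point (vec q) = point (vec p) \<or> point (vec q) = point (vec ?p')"
    if q: "q \<noteq> (0, 0)" for q
    using zeros_of_member[OF assms p(1) ab(2) zero, of q] member_points[OF q]
      point_vec_eq[OF p(1) q] point_vec_eq[OF p' q] by (auto simp: ab(1))
  then have "quadric_points scale Q \<inter> line = {point (vec p), conj_fun ` point (vec p)}"
    unfolding image_conj_fun_point proj_space_E using p(1) p' by blast
  then show "\<exists>P\<in>line. quadric_points scale Q \<inter> line = {P, conj_fun ` P}"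
    using p(1) unfolding proj_space_E by blast
qed

lemma third_point:
  obtains X where "X \<in> line" "X \<noteq> P" "X \<noteq> P'"
  using three_points by metis

lemma swapped_not_line_in_member:
  assumes "swapped_by \<sigma>"
  shows "\<not> line_in_member"
proof
  assume "line_in_member"
  then obtain Q where Q: "Q \<in> pencil R S" "quadric_points scale Q \<inter> line = line"
    unfolding line_in_member_def by blast
  moreover have "line \<noteq> {}" using three_points by blast
  ultimately obtain P where "line = {P, \<sigma> P}" using assms unfolding swapped_by_def by metis
  with third_point[of P "\<sigma> P"] show False by blast
qed

lemma member_through:
  assumes "X \<in> line"
  obtains Q where "Q \<in> pencil R S" "X \<in> quadric_points scale Q"
proof -
  obtain p where p: "X = point (vec p)" "p \<noteq> (0, 0)" using assms unfolding proj_space_E by blast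
  show thesis
  proof (cases "qval (form_coefs R) p = 0")
    case True
    then show thesis
      using that[OF member_in_pencil[of 1 0]] by (simp add: p member_points)
  next
    case False
    then show thesis
      using that[OF member_in_pencil[of "qval (form_coefs S) p" "- qval (form_coefs R) p"]]
      by (simp add: p member_points mult.commute)
  qed
qed

text \<open>
  All quadrics through a third point \<open>X\<close> also pass through the common zero \<open>P\<close>, but a pair
  \<open>{P', \<sigma> P'}\<close> containing \<open>P\<close> is \<open>{P, \<sigma> P}\<close> and leaves no room for \<open>X\<close>.
\<close>

lemma swapped_not_base_point:
  assumes inv: "involution scale E \<sigma>" and "swapped_by \<sigma>"
  shows "\<not> base_point"
proof
  assume "base_point"
  then obtain P where P: "P \<in> line" "\<And>Q. Q \<in> pencil R S \<Longrightarrow> P \<in> quadric_points scale Q"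
    unfolding base_point_def by blast
  obtain X where X: "X \<in> line" "X \<noteq> P" "X \<noteq> \<sigma> P" by (rule third_point)
  obtain Q where Q: "Q \<in> pencil R S" "X \<in> quadric_points scale Q" using member_through[OF X(1)] .
  obtain P' where P': "P' \<in> line" "quadric_points scale Q \<inter> line = {P', \<sigma> P'}"
    using assms(2) Q X(1) unfolding swapped_by_def by blast
  have "\<sigma> (\<sigma> P') = P'" using inv P'(1) by (simp add: involution_def)
  moreover have "P \<in> {P', \<sigma> P'}" "X \<in> {P', \<sigma> P'}"
    using P(1) P(2)[OF Q(1)] Q(2) X(1) by (simp_all flip: P'(2))
  ultimately show False using X(2,3) by auto
qed

text \<open>
  The resultant of the extended forms is the image of the resultant over \<open>K\<close>, so the generators
  themselves have no common zero over \<open>L\<close>.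
\<close>

lemma disjoint_ext:
  assumes "resultant_RS \<noteq> 0"
  shows "\<exists>Q1\<in>pencil R S. \<exists>Q2\<in>pencil R S. Q1 \<noteq> Q2 \<and>
    quadric_points_ext scale emb E Q1 \<inter> quadric_points_ext scale emb E Q2 = {}"
proof (intro bexI conjI)
  show "member 1 0 \<noteq> member 0 1"
  proof
    assume eq: "member 1 0 = member 0 1"
    have "R \<in> member 1 0" unfolding member_def quadric_def by (auto intro!: exI[of _ 1])
    then obtain c where "R = (\<lambda>x y. c * S x y)"
      unfolding eq by (auto simp: member_def quadric_def)
    then have "\<forall>x y. 1 * R x y + (- c) * S x y = 0" by simp
    then show False using indep_forms unfolding independent_forms_def by (metis zero_neq_one)
  qed
  show "quadric_points_ext scale emb E (member 1 0) \<inter> quadric_points_ext scale emb E (member 0 1) = {}"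
  proof (rule ccontr)
    assume "\<not> ?thesis"
    then obtain P where P: "P \<in> quadric_points_ext scale emb E (member 1 0)"
      "P \<in> quadric_points_ext scale emb E (member 0 1)" by blast
    then obtain p where p: "P = tensor_point (tensor_vec p)" "p \<noteq> (0, 0)"
      unfolding quadric_points_ext_def proj_space_ext by blast
    have "resultant (emb_coefs (form_coefs R)) (emb_coefs (form_coefs S)) \<noteq> 0" using assms by (simp add: resultant_emb)
    from no_common_zero[OF this p(2)] show False
      using P unfolding p(1) member_points_ext[OF p(2)] by (simp add: hom_one)
  qed
qed (auto intro: member_in_pencil)

text \<open>
  A common zero of the extended generators would lie on both disjoint quadrics. Each of the
  two excluded situations produces one.
\<close>

lemma disjoint_ext_imp:
  assumes Q: "Q1 \<in> pencil R S" "Q2 \<in> pencil R S"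
    and disj: "quadric_points_ext scale emb E Q1 \<inter> quadric_points_ext scale emb E Q2 = {}"
  shows "\<not> line_in_member" "\<not> base_point"
proof -
  have no_zero: False
    if p: "p \<noteq> (0, 0)" "qval (emb_coefs (form_coefs R)) p = 0" "qval (emb_coefs (form_coefs S)) p = 0" for p
  proof -
    have "tensor_point (tensor_vec p) \<in> quadric_points_ext scale emb E Q" if "Q \<in> pencil R S" for Q
      using that p member_points_ext[OF p(1)] by (auto simp: pencil_eq)
    with Q disj show False by blast
  qed
  show "\<not> base_point"
  proof
    assume "base_point"
    then obtain x y where "(x, y) \<noteq> (0, 0)" "qval (form_coefs R) (x, y) = 0" "qval (form_coefs S) (x, y) = 0"
      unfolding base_point_iff by (metis surj_pair)
    then show False using no_zero[of "(emb x, emb y)"] unfolding qval_emb by simp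
  qed
  show "\<not> line_in_member"
  proof
    assume "line_in_member"
    then obtain a b where ab: "(a, b) \<noteq> (0, 0)"
      and z: "\<And>p. p \<noteq> (0, 0) \<Longrightarrow> a * qval (form_coefs R) p + b * qval (form_coefs S) p = 0"
      unfolding line_in_member_iff by blast
    \<comment> \<open>A relation between the values of two forms over \<open>K\<close> passes to \<open>L\<close> only through their
      coefficients. These are recovered from the values at three points, up to a division by \<open>2\<close>.\<close>
    have coef_zero: "emb a * qval (emb_coefs (form_coefs R)) p + emb b * qval (emb_coefs (form_coefs S)) p = 0" for p
    proof -
      obtain r0 r1 r2 s0 s1 s2 where rs: "form_coefs R = (r0, r1, r2)" "form_coefs S = (s0, s1, s2)"
        by (cases "form_coefs R"; cases "form_coefs S")
      have 0: "a * r0 + b * s0 = 0" "a * r2 + b * s2 = 0"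
        using z[of "(1, 0)"] z[of "(0, 1)"] by (simp_all add: rs)
      have "2 * (a * r1 + b * s1) = (a * qval (form_coefs R) (1, 1) + b * qval (form_coefs S) (1, 1))
          - (a * r0 + b * s0) - (a * r2 + b * s2)"
        by (simp add: rs algebra_simps)
      then have "2 * (a * r1 + b * s1) = 0" using z[of "(1, 1)"] 0 by simp
      then have 1: "a * r1 + b * s1 = 0"
        using two_nonzero mult_eq_0_iff[of 2 "a * r1 + b * s1"] by blast
      obtain x y where p: "p = (x, y)" by (cases p)
      have "emb a * qval (emb_coefs (form_coefs R)) p + emb b * qval (emb_coefs (form_coefs S)) p =
          emb (a * r0 + b * s0) * x^2 + 2 * emb (a * r1 + b * s1) * x * y + emb (a * r2 + b * s2) * y^2"
        by (simp add: rs p emb_coefs_def hom_add hom_mult algebra_simps)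
      then show ?thesis unfolding 0 1 by simp
    qed
    show False
    \<comment> \<open>One generator is proportional to the other on the line; a zero of the latter is common to both.\<close>
    proof (cases "a = 0")
      case True
      obtain p where p: "p \<noteq> (0, 0)" "qval (emb_coefs (form_coefs R)) p = 0" by (rule qval_has_zero)
      then show False using no_zero[OF p] coef_zero[of p] ab True by simp
    next
      case False
      obtain p where p: "p \<noteq> (0, 0)" "qval (emb_coefs (form_coefs S)) p = 0" by (rule qval_has_zero)
      then show False using no_zero[OF p(1) _ p(2)] coef_zero[of p] False by simp
    qed
  qed
qed

theorem involution_base_point_disjoint_iff:
  "((\<exists>\<sigma>. involution scale E \<sigma> \<and> swapped_by \<sigma>) \<longleftrightarrow> \<not> line_in_member \<and> \<not> base_point) \<and>
   (\<not> line_in_member \<and> \<not> base_point \<longleftrightarrow>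
     (\<exists>Q1\<in>pencil R S. \<exists>Q2\<in>pencil R S. Q1 \<noteq> Q2 \<and>
        quadric_points_ext scale emb E Q1 \<inter> quadric_points_ext scale emb E Q2 = {}))"
  using resultant_nonzero involution_conj_fun swapped_by_conj_fun swapped_not_line_in_member
    swapped_not_base_point disjoint_ext disjoint_ext_imp
  by meson

end

section \<open>The equivalence\<close>

lemma (in vector_space) plane_basis_exists:
  assumes "subspace E" "dim E = 2"
  obtains e1 e2 where "plane_basis scale E e1 e2"
proof -
  obtain B where B: "B \<subseteq> E" "independent B" "E \<subseteq> span B" "card B = dim E"
    using basis_exists .
  then obtain e1 e2 where e: "B = {e1, e2}" "e1 \<noteq> e2"
    using assms(2) by (metis card_2_iff)
  have "E = span {e1, e2}"
    using B e assms(1) span_minimal by blast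
  moreover have "span {e1, e2} = {scale x e1 + scale y e2 | x y. True}"
  proof (intro set_eqI iffI)
    fix v assume "v \<in> span {e1, e2}"
    then obtain x y where "v - scale x e1 = scale y e2"
      unfolding span_insert[of e1] span_singleton by auto
    then have "v = scale x e1 + scale y e2" by (simp add: algebra_simps)
    then show "v \<in> {scale x e1 + scale y e2 | x y. True}" by blast
  next
    fix v assume "v \<in> {scale x e1 + scale y e2 | x y. True}"
    then show "v \<in> span {e1, e2}"
      by (elim CollectE exE conjE) (simp add: span_add span_scale span_base)
  qed
  moreover have "x = 0 \<and> y = 0" if zero: "scale x e1 + scale y e2 = 0" for x y
  proof -
    have ind: "e1 \<notin> span {e2}" "e2 \<noteq> 0"
      using B(2) e by (auto simp: independent_insert)
    have "x = 0"
    proof (rule ccontr)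
      assume "x \<noteq> 0"
      then have "e1 = scale (inverse x) (scale x e1)" by simp
      also have "scale x e1 = scale (- y) e2"
        using zero by (simp add: eq_neg_iff_add_eq_0)
      also have "scale (inverse x) \<dots> \<in> span {e2}" by (intro span_scale span_base) simp
      finally show False using ind(1) by blast
    qed
    with zero ind(2) show ?thesis by simp
  qed
  ultimately show thesis
    by (intro that plane_basis.intro vector_space_axioms plane_basis_axioms.intro) auto
qed

theorem mainTheorem1:
  fixes scale :: "'k::field \<Rightarrow> 'v::ab_group_add \<Rightarrow> 'v"
    and R S :: "'v \<Rightarrow> 'v \<Rightarrow> 'k"
    and E :: "'v set"
    and emb :: "'k \<Rightarrow> 'l::alg_closed_field"
  assumes "CHAR('k) \<noteq> 2"
    and "vector_space scale"
    and "sym_bilinear scale R" and "sym_bilinear scale S"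
    and "independent_forms R S"
    and "Modules.module.subspace scale E" and "vector_space.dim scale E = 2"
    and "alg_closure_embedding emb"
  shows
    "((\<exists>\<sigma>. involution scale E \<sigma> \<and>
        (\<forall>Q\<in>pencil R S. quadric_points scale Q \<inter> proj_space scale 0 E \<noteq> {} \<longrightarrow>
          (\<exists>P\<in>proj_space scale 0 E.
             quadric_points scale Q \<inter> proj_space scale 0 E = {P, \<sigma> P})))
      \<longleftrightarrow>
      (\<forall>Q\<in>pencil R S. \<not> proj_space scale 0 E \<subseteq> quadric_points scale Q) \<and>
      \<not> (\<exists>P\<in>proj_space scale 0 E. \<forall>Q\<in>pencil R S. P \<in> quadric_points scale Q))
     \<and>
     ((\<forall>Q\<in>pencil R S. \<not> proj_space scale 0 E \<subseteq> quadric_points scale Q) \<and>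
      \<not> (\<exists>P\<in>proj_space scale 0 E. \<forall>Q\<in>pencil R S. P \<in> quadric_points scale Q)
      \<longleftrightarrow>
      (\<exists>Q1\<in>pencil R S. \<exists>Q2\<in>pencil R S. Q1 \<noteq> Q2 \<and>
         quadric_points_ext scale emb E Q1 \<inter> quadric_points_ext scale emb E Q2 = {}))"
proof -
  interpret vector_space scale by fact
  obtain e1 e2 where "plane_basis scale E e1 e2"
    using plane_basis_exists assms(6,7) by blast
  moreover have "(2::'k) \<noteq> 0"
  proof
    assume "(2::'k) = 0"
    then have "CHAR('k) dvd 2" using of_nat_eq_0_iff_char_dvd[of 2, where ?'a = 'k] by simp
    with assms(1) have "CHAR('k) = 1" using prime_nat_iff two_is_prime_nat by blast
    then show False using of_nat_CHAR[where ?'a = 'k] by simp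
  qed
  ultimately interpret pencil_on_line scale E e1 e2 emb R S
    using assms by (simp add: pencil_on_line_def plane_ext_def pencil_on_line_axioms_def)
  show ?thesis
    using involution_base_point_disjoint_iff unfolding swapped_by_def line_in_member_def base_point_def by (simp only: bex_simps)
qed

end
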